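(* For every integer $n\ge 4$, $\sigma_{od}\mathrm{moex}(n+1)>\sigma_{od}\mathrm{moex}(n)$.
   Context: For $n\ge 0$, $\mathcal{P}_{od}(n)$ is the set of all partitions of $n$ in which no odd part is repeated (even parts may appear with any multiplicity). For $\lambda\in\mathcal{P}_{od}(n)$, $\mathrm{moex}(\lambda)$ is the smallest positive odd integer that is not a part of $\lambda$. Define $\sigma_{od}\mathrm{moex}(n):=\sum_{\lambda\in\mathcal{P}_{od}(n)}\mathrm{moex}(\lambda)$. *)

theory Defs
  imports Complex_Main "HOL-Library.Multiset"
begin

text \<open>A partition of \<open>n\<close> is a finite multiset of positive integers with sum \<open>n\<close>.\<close>

definition P_od :: "nat \<Rightarrow> nat multiset set" where
  "P_od n = {M. (\<forall>k\<in>#M. 0 < k) \<and> sum_mset M = n \<and> (\<forall>k. odd k \<longrightarrow> count M k \<le> 1)}"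

definition moex :: "nat multiset \<Rightarrow> nat" where
  "moex M = (LEAST k. odd k \<and> k \<notin># M)"

definition sigma_od_moex :: "nat \<Rightarrow> nat" where
  "sigma_od_moex n = (\<Sum>M\<in>P_od n. moex M)"

lemma finite_P_od: "finite (P_od n)"
proof -
  have size_le: "size M \<le> sum_mset M" if "\<forall>k\<in>#M. 0 < k" for M :: "nat multiset"
    using that by (induction M) auto
  have part_le: "k \<le> sum_mset M" if "k \<in># M" for k and M :: "nat multiset"
    using that by (metis le_add1 sum_mset.remove)
  have "P_od n \<subseteq> mset ` {xs. set xs \<subseteq> {..n} \<and> length xs \<le> n}"
  proof
    fix M assume M: "M \<in> P_od n"
    obtain xs where xs: "mset xs = M" by (metis ex_mset)
    have "set xs \<subseteq> {..n}" "length xs \<le> n"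
      using M size_le[of M] part_le[of _ M] xs by (auto simp: P_od_def)
    then show "M \<in> mset ` {xs. set xs \<subseteq> {..n} \<and> length xs \<le> n}"
      using xs by blast
  qed
  then show ?thesis
    by (rule finite_subset) (intro finite_imageI finite_lists_length_le finite_atMost)
qed

lemma moex_odd_notin: "odd (moex M) \<and> moex M \<notin># M"
proof -
  define k where "k = 2 * sum_mset M + 1"
  have "x \<le> sum_mset M" if "x \<in># M" for x
    using that by (metis le_add1 sum_mset.remove)
  from this[of k] have "k \<notin># M"
    unfolding k_def by linarith
  moreover have "odd k"
    unfolding k_def by simp
  ultimately have "odd k \<and> k \<notin># M" by simp
  then show ?thesis
    unfolding moex_def by (rule LeastI)
qed

end

theory Submission
  imports Defs "HOL-Computational_Algebra.Formal_Power_Series"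
begin

text \<open>
  Write \<open>F j k\<close> for the generating function of partitions into even parts \<open>\<ge> 2k\<close> and distinct odd
  parts \<open>\<ge> 2j+1\<close>. As \<open>moex \<lambda>\<close> is odd, summing \<open>moex \<lambda> + 1\<close> counts every \<open>j\<close> with
  \<open>1, 3, \<dots>, 2j-1\<close> all in \<open>\<lambda>\<close> twice, so \<open>\<sigma>\<close> has generating function
  \<open>2 (\<Sum>j. q^(j^2) F j 1) - F 0 1\<close>. Two steps of the Rogers--Fine transformation, each of them a
  telescoping sum, turn \<open>(1 - q) \<sigma>\<close> into
  \<open>F 1 2 (1 + 2q - 2q^2 + 2q^3 - 2q^7 + 2q^8) + 2 q^10 (1 - q) U\<close> with
  \<open>U = (\<Sum>n. q^(n^2 + 8n) F (n+2) 3)\<close>, and positivity of the remainder in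
  the third step bounds \<open>U\<close> by \<open>F 2 3 \<le> U \<le> (1 + q^9) F 2 3\<close>. The resulting lower bound is a multiple
  \<open>C \<cdot> F 2 4\<close> with an explicit series \<open>C\<close> whose only negative coefficient is \<open>-2\<close>, at \<open>q^2\<close>. It is
  compensated by deleting one part \<open>s \<ge> 5\<close> from a partition counted by \<open>F 2 4\<close> and charging the
  result to the coefficient of \<open>C\<close> at \<open>q^(s+2)\<close>.
\<close>

unbundle fps_syntax

section \<open>Generating functions of partitions with lower bounds on odd and even parts\<close>

definition parts_from :: "nat \<Rightarrow> nat \<Rightarrow> nat \<Rightarrow> nat multiset set" where
  "parts_from j k n = {M \<in> P_od n. \<forall>x\<in>#M. (odd x \<longrightarrow> 2 * j + 1 \<le> x) \<and> (even x \<longrightarrow> 2 * k \<le> x)}"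

definition gf :: "nat \<Rightarrow> nat \<Rightarrow> int fps" where
  "gf j k = Abs_fps (\<lambda>n. int (card (parts_from j k n)))"

lemma finite_parts_from: "finite (parts_from j k n)"
  unfolding parts_from_def using finite_P_od by simp

lemma gf_nth: "gf j k $ n = int (card (parts_from j k n))"
  by (simp add: gf_def)

lemma gf_nth_nonneg: "0 \<le> gf j k $ n"
  by (simp add: gf_nth)

lemma parts_from_add_msetD:
  assumes "add_mset s N \<in> parts_from j k m"
  shows "N \<in> parts_from j k (m - s)" "s \<le> m"
    "odd s \<Longrightarrow> 2 * j + 1 \<le> s" "even s \<Longrightarrow> 2 * k \<le> s"
proof -
  have "count N x \<le> 1" if "odd x" for x
  proof -
    have "count (add_mset s N) x \<le> 1" using assms that unfolding parts_from_def P_od_def by blast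
    then show ?thesis by (simp split: if_splits)
  qed
  then show "N \<in> parts_from j k (m - s)"
    using assms by (auto simp: parts_from_def P_od_def)
qed (use assms in \<open>auto simp: parts_from_def P_od_def\<close>)

text \<open>Split by whether \<open>2 * j + 1\<close> occurs. If it does, it occurs once, so
  deleting it leaves odd parts at least \<open>2 * j + 3\<close>.\<close>

lemma gf_odd_step: "gf j k = (1 + fps_X ^ (2 * j + 1)) * gf (Suc j) k"
proof (rule fps_ext)
  fix n
  let ?a = "2 * j + 1"
  define S where "S = (if n < ?a then {} else add_mset ?a ` parts_from (Suc j) k (n - ?a))"
  have eq: "parts_from j k n = parts_from (Suc j) k n \<union> S"
  proof (intro equalityI subsetI)
    fix M assume M: "M \<in> parts_from j k n"
    show "M \<in> parts_from (Suc j) k n \<union> S"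
    proof (cases "?a \<in># M")
      case True
      then obtain N where N: "M = add_mset ?a N" by (metis mset_add)
      have "count M ?a \<le> 1" using M by (simp add: parts_from_def P_od_def)
      then have notin: "?a \<notin># N" using N by (simp add: not_in_iff)
      have "2 * Suc j + 1 \<le> x" if "x \<in># N" "odd x" for x
      proof -
        have "?a \<le> x" using M N that by (auto simp: parts_from_def)
        moreover have "x \<noteq> ?a" using notin that by auto
        moreover have "x \<noteq> ?a + 1" using that by auto
        ultimately show ?thesis by simp
      qed
      then have "N \<in> parts_from (Suc j) k (n - ?a)" "n \<ge> ?a"
        using parts_from_add_msetD[of ?a N j k n] M N by (auto simp: parts_from_def)
      then show ?thesis using N S_def by auto
    next
      case False
      have "2 * Suc j + 1 \<le> x" if "x \<in># M" "odd x" for x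
      proof -
        have "?a \<le> x" using M that by (auto simp: parts_from_def)
        moreover have "x \<noteq> ?a" using False that by auto
        moreover have "x \<noteq> ?a + 1" using that by auto
        ultimately show ?thesis by simp
      qed
      then have "M \<in> parts_from (Suc j) k n" using M by (auto simp: parts_from_def)
      then show ?thesis by simp
    qed
  next
    fix M assume "M \<in> parts_from (Suc j) k n \<union> S"
    then show "M \<in> parts_from j k n"
    proof
      assume "M \<in> parts_from (Suc j) k n"
      then show ?thesis by (force simp: parts_from_def)
    next
      assume "M \<in> S"
      then obtain N where N: "M = add_mset ?a N" "N \<in> parts_from (Suc j) k (n - ?a)" "n \<ge> ?a"
        by (auto simp: S_def split: if_splits)
      have "?a \<notin># N" using N(2) by (force simp: parts_from_def)
      then have "count N ?a = 0" by (simp add: not_in_iff)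
      then show ?thesis using N by (force simp: parts_from_def P_od_def)
    qed
  qed
  have "?a \<notin># M" if "M \<in> parts_from (Suc j) k n" for M
    using that by (force simp: parts_from_def)
  then have disj: "parts_from (Suc j) k n \<inter> S = {}"
    unfolding S_def by (force split: if_splits)
  have finS: "finite S" by (simp add: S_def finite_parts_from)
  have cS: "card S = (if n < ?a then 0 else card (parts_from (Suc j) k (n - ?a)))"
    by (simp add: S_def card_image inj_on_def)
  show "gf j k $ n = ((1 + fps_X ^ ?a) * gf (Suc j) k) $ n"
    unfolding gf_nth distrib_right fps_add_nth fps_X_power_mult_nth mult_1
    unfolding eq card_Un_disjoint[OF finite_parts_from finS disj] cS by simp
qed

text \<open>Even parts may repeat, so deleting one copy of \<open>2 * k\<close> stays in the same
  family; this is why \<open>gf j k\<close> recurs on the right.\<close>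

lemma gf_even_step:
  assumes "k > 0"
  shows "gf j k = gf j (Suc k) + fps_X ^ (2 * k) * gf j k"
proof (rule fps_ext)
  fix n
  let ?a = "2 * k"
  define S where "S = (if n < ?a then {} else add_mset ?a ` parts_from j k (n - ?a))"
  have eq: "parts_from j k n = parts_from j (Suc k) n \<union> S"
  proof (intro equalityI subsetI)
    fix M assume M: "M \<in> parts_from j k n"
    show "M \<in> parts_from j (Suc k) n \<union> S"
    proof (cases "?a \<in># M")
      case True
      then obtain N where N: "M = add_mset ?a N" by (metis mset_add)
      have "N \<in> parts_from j k (n - ?a)" "n \<ge> ?a"
        using parts_from_add_msetD[of ?a N j k n] M N by auto
      then show ?thesis using N S_def by auto
    next
      case False
      have "2 * Suc k \<le> x" if "x \<in># M" "even x" for x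
      proof -
        have "?a \<le> x" using M that by (auto simp: parts_from_def)
        moreover have "x \<noteq> ?a" using False that by auto
        moreover have "x \<noteq> ?a + 1" using that by auto
        ultimately show ?thesis by simp
      qed
      then have "M \<in> parts_from j (Suc k) n" using M by (auto simp: parts_from_def)
      then show ?thesis by simp
    qed
  next
    fix M assume "M \<in> parts_from j (Suc k) n \<union> S"
    then show "M \<in> parts_from j k n"
    proof
      assume "M \<in> parts_from j (Suc k) n"
      then show ?thesis by (force simp: parts_from_def)
    next
      assume "M \<in> S"
      then obtain N where N: "M = add_mset ?a N" "N \<in> parts_from j k (n - ?a)" "n \<ge> ?a"
        by (auto simp: S_def split: if_splits)
      then show ?thesis using assms by (force simp: parts_from_def P_od_def)
    qed
  qed
  have "?a \<notin># M" if "M \<in> parts_from j (Suc k) n" for M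
    using that by (force simp: parts_from_def)
  then have disj: "parts_from j (Suc k) n \<inter> S = {}"
    unfolding S_def by (force split: if_splits)
  have finS: "finite S" by (simp add: S_def finite_parts_from)
  have cS: "card S = (if n < ?a then 0 else card (parts_from j k (n - ?a)))"
    by (simp add: S_def card_image inj_on_def)
  have "card (parts_from j k n) = card (parts_from j (Suc k) n) + card S"
    using card_Un_disjoint[OF finite_parts_from finS disj] eq by simp
  then show "gf j k $ n = (gf j (Suc k) + fps_X ^ ?a * gf j k) $ n"
    by (simp add: gf_nth fps_X_power_mult_nth cS)
qed

section \<open>Staircases of odd parts and the generating function of sigma\<close>

definition odd_stair :: "nat \<Rightarrow> nat multiset" where
  "odd_stair j = image_mset (\<lambda>i. 2 * i + 1) (mset_set {..<j})"

lemma sum_mset_odd_stair: "sum_mset (odd_stair j) = j\<^sup>2"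
  by (induction j) (simp_all add: odd_stair_def lessThan_Suc power2_eq_square)

lemma count_odd_stair: "count (odd_stair j) x = (if odd x \<and> x < 2 * j then 1 else 0)"
proof (induction j)
  case 0
  then show ?case by (simp add: odd_stair_def)
next
  case (Suc j)
  have "odd_stair (Suc j) = add_mset (2 * j + 1) (odd_stair j)"
    by (simp add: odd_stair_def lessThan_Suc)
  then show ?case using Suc by (auto elim!: oddE)
qed

text \<open>Deleting the staircase is a bijection: odd parts do not repeat, so the remaining ones
  exceed \<open>2 * j\<close>, and the sum drops by \<open>j\<^sup>2\<close>.\<close>

lemma card_P_od_odd_stair:
  "int (card {M \<in> P_od n. odd_stair j \<subseteq># M}) = (fps_X ^ j\<^sup>2 * gf j 1) $ n"
proof -
  have eq: "{M \<in> P_od n. odd_stair j \<subseteq># M}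
      = (if n < j\<^sup>2 then {} else (\<lambda>N. N + odd_stair j) ` parts_from j 1 (n - j\<^sup>2))"
    (is "?L = ?R")
  proof (intro equalityI subsetI)
    fix M assume M: "M \<in> ?L"
    define N where "N = M - odd_stair j"
    have MN: "M = N + odd_stair j" using M by (simp add: N_def)
    have sum: "n = sum_mset N + j\<^sup>2"
      using M MN by (simp add: P_od_def sum_mset_odd_stair)
    have cnt: "count N x + count (odd_stair j) x \<le> 1" if "odd x" for x
      using M that by (simp add: MN P_od_def)
    have "2 * j + 1 \<le> x" if "x \<in># N" "odd x" for x
    proof -
      have "count N x \<ge> 1" using that(1) by (simp add: Suc_le_eq)
      with cnt[OF that(2)] have "count (odd_stair j) x = 0" by linarith
      with that(2) show ?thesis by (auto simp: count_odd_stair elim!: oddE split: if_splits)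
    qed
    moreover have "2 \<le> x" if "x \<in># N" "even x" for x
    proof -
      have "0 < x" using M that(1) by (auto simp: MN P_od_def)
      with that(2) show ?thesis by (auto elim!: evenE)
    qed
    moreover have "count N x \<le> 1" if "odd x" for x
      using cnt[OF that] by linarith
    moreover have "\<forall>x\<in>#N. 0 < x" using M by (auto simp: MN P_od_def)
    ultimately have "N \<in> parts_from j 1 (n - j\<^sup>2)"
      using sum by (auto simp: parts_from_def P_od_def)
    then show "M \<in> ?R" using sum MN by auto
  next
    fix M assume "M \<in> ?R"
    then obtain N where N: "M = N + odd_stair j" "N \<in> parts_from j 1 (n - j\<^sup>2)" "j\<^sup>2 \<le> n"
      by (auto split: if_splits)
    have "count M x \<le> 1" if "odd x" for x
    proof (cases "x < 2 * j")
      case True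
      then have "x \<notin># N" using N(2) that by (force simp: parts_from_def)
      then show ?thesis using N(1) by (simp add: count_odd_stair not_in_iff)
    next
      case False
      then show ?thesis using N that by (simp add: count_odd_stair parts_from_def P_od_def)
    qed
    moreover have "0 < x" if "x \<in># M" for x
    proof -
      have "x \<in># N \<or> odd x" using that N(1) by (auto simp: odd_stair_def)
      then show ?thesis using N(2) by (auto simp: parts_from_def P_od_def elim: oddE)
    qed
    moreover have "sum_mset M = n" using N by (simp add: parts_from_def P_od_def sum_mset_odd_stair)
    ultimately show "M \<in> ?L" using N(1) by (simp add: P_od_def)
  qed
  show ?thesis
    unfolding eq by (simp add: fps_X_power_mult_nth gf_nth card_image inj_on_def)
qed

lemma odd_stair_subset_iff: "odd_stair j \<subseteq># M \<longleftrightarrow> 2 * j \<le> moex M"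
proof
  assume "odd_stair j \<subseteq># M"
  then have le: "count (odd_stair j) x \<le> count M x" for x
    by (simp add: mset_subset_eq_count)
  show "2 * j \<le> moex M"
  proof (rule ccontr)
    assume "\<not> 2 * j \<le> moex M"
    then have "count (odd_stair j) (moex M) = 1"
      using moex_odd_notin[of M] by (simp add: count_odd_stair)
    with le[of "moex M"] show False
      using moex_odd_notin[of M] by (simp add: not_in_iff)
  qed
next
  assume le: "2 * j \<le> moex M"
  have "x \<in># M" if "odd x" "x < 2 * j" for x
    using not_less_Least[of x "\<lambda>k. odd k \<and> k \<notin># M"] that le by (auto simp: moex_def)
  then show "odd_stair j \<subseteq># M"
    by (auto intro!: mset_subset_eqI simp: count_odd_stair Suc_le_eq)
qed

text \<open>With \<open>moex M = 2 * t + 1\<close>, the staircases contained in \<open>M\<close> are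
  those with \<open>j\<close> from 0 to \<open>t\<close>. The bound on \<open>n\<close> forces
  \<open>t < J\<close>, so the finite sum sees all of them.\<close>

lemma moex_eq_sum_odd_stair:
  assumes "M \<in> P_od n" "n < J\<^sup>2"
  shows "int (moex M) + 1 = 2 * (\<Sum>j<J. if odd_stair j \<subseteq># M then 1 else 0)"
proof -
  obtain t where t: "moex M = 2 * t + 1"
    using moex_odd_notin[of M] by (auto elim: oddE)
  have "odd_stair t \<subseteq># M" using t by (simp add: odd_stair_subset_iff)
  then obtain N where "M = odd_stair t + N" by (auto simp: mset_subset_eq_exists_conv)
  then have "t\<^sup>2 \<le> n" using assms(1) by (auto simp: P_od_def sum_mset_odd_stair)
  with assms(2) have "t < J" by (meson le_less_trans power_less_imp_less_base zero_le)
  have "(\<Sum>j<J. if odd_stair j \<subseteq># M then 1 else 0 :: int) = (\<Sum>j\<in>{..<J} \<inter> {j. j \<le> t}. 1)"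
    by (subst sum.inter_restrict) (auto simp: odd_stair_subset_iff t intro!: sum.cong)
  also have "{..<J} \<inter> {j. j \<le> t} = {..t}" using \<open>t < J\<close> by auto
  finally show ?thesis using t by simp
qed

text \<open>The series reached after \<open>k\<close> Rogers--Fine steps, truncated at
  \<open>J\<close> so that only finite sums occur; \<open>k = 2\<close> gives
  \<open>U\<close>.\<close>

definition stair_sum :: "nat \<Rightarrow> nat \<Rightarrow> int fps" where
  "stair_sum k J = (\<Sum>n<J. fps_X ^ (n\<^sup>2 + 4 * k * n) * gf (n + k) (Suc k))"

lemma P_od_eq_parts_from: "P_od n = parts_from 0 1 n"
  by (force simp: parts_from_def P_od_def elim: oddE evenE)

lemma sigma_od_moex_eq:
  assumes "n < J\<^sup>2"
  shows "int (sigma_od_moex n) = (2 * stair_sum 0 J - gf 0 1) $ n"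
proof -
  have "int (sigma_od_moex n) + int (card (P_od n)) = (\<Sum>M\<in>P_od n. int (moex M) + 1)"
    by (simp add: sigma_od_moex_def sum.distrib)
  also have "\<dots> = (\<Sum>M\<in>P_od n. 2 * (\<Sum>j<J. if odd_stair j \<subseteq># M then 1 else 0))"
    using moex_eq_sum_odd_stair[OF _ assms] by (intro sum.cong) auto
  also have "\<dots> = 2 * (\<Sum>j<J. \<Sum>M\<in>P_od n. if odd_stair j \<subseteq># M then 1 else 0)"
    by (simp add: sum_distrib_left[symmetric] sum.swap[of _ "P_od n"])
  also have "\<dots> = 2 * (\<Sum>j<J. int (card {M \<in> P_od n. odd_stair j \<subseteq># M}))"
    by (simp add: sum.inter_filter[symmetric] finite_P_od)
  also have "\<dots> = (2 * stair_sum 0 J) $ n"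
    by (simp add: card_P_od_odd_stair stair_sum_def fps_sum_nth numeral_fps_const)
  finally show ?thesis by (simp add: gf_nth P_od_eq_parts_from)
qed

text \<open>One step of the Rogers--Fine iteration, in the form of a telescoping sum.\<close>

lemma stair_sum_step:
  "stair_sum k J + fps_X ^ (6 * k + 2) * stair_sum (Suc k) J
     + fps_X ^ (J\<^sup>2 + 4 * k * J) * (1 + fps_X ^ (2 * J + 4 * k + 1)) * gf (J + k) (Suc k)
   = (1 + fps_X ^ (4 * k + 1)) * gf k (Suc k)"
proof (induction J)
  case 0
  then show ?case by (simp add: stair_sum_def)
next
  case (Suc J)
  define x :: "int fps" where "x = fps_X"
  define G where "G = gf (Suc (J + k)) (Suc k)"
  have odd: "gf (J + k) (Suc k) = (1 + x ^ (2 * (J + k) + 1)) * G"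
    using gf_odd_step[of "J + k" "Suc k"] by (simp only: x_def G_def)
  have even: "gf (Suc (J + k)) (Suc (Suc k)) = G - x ^ (2 * Suc k) * G"
    using gf_even_step[of "Suc k" "Suc (J + k)"] by (simp add: x_def G_def eq_diff_eq)
  \<comment> \<open>Naming these powers removes the variable exponents, so the induction step
    becomes a polynomial identity.\<close>
  define y where "y = x ^ J"
  define z where "z = x ^ k"
  define p where "p = x ^ (J\<^sup>2 + 4 * k * J)"
  have pw: "x ^ (2 * (J + k) + 1) = y\<^sup>2 * z\<^sup>2 * x"
    "x ^ (6 * k + 2) = z ^ 6 * x\<^sup>2"
    "x ^ (2 * Suc k) = z\<^sup>2 * x\<^sup>2"
    "x ^ (2 * J + 4 * k + 1) = y\<^sup>2 * z ^ 4 * x"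
    "x ^ (2 * Suc J + 4 * k + 1) = y\<^sup>2 * z ^ 4 * x ^ 3"
    "x ^ (J\<^sup>2 + 4 * Suc k * J) = p * y ^ 4"
    "x ^ ((Suc J)\<^sup>2 + 4 * k * Suc J) = p * y\<^sup>2 * z ^ 4 * x"
    unfolding y_def z_def p_def power_mult[symmetric] power_add[symmetric] power_Suc2[symmetric]
    by (rule arg_cong[where f = "power x"], simp add: algebra_simps power2_eq_square)+
  have key: "p * ((1 + y\<^sup>2 * z\<^sup>2 * x) * G)
      + z ^ 6 * x\<^sup>2 * (p * y ^ 4 * (G - z\<^sup>2 * x\<^sup>2 * G))
      + p * y\<^sup>2 * z ^ 4 * x * (1 + y\<^sup>2 * z ^ 4 * x ^ 3) * G
    = p * (1 + y\<^sup>2 * z ^ 4 * x) * ((1 + y\<^sup>2 * z\<^sup>2 * x) * G)"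
    by algebra
  show ?case
    unfolding Suc.IH[symmetric]
    unfolding stair_sum_def sum.lessThan_Suc add_Suc add_Suc_right x_def[symmetric]
    unfolding odd even G_def[symmetric] pw p_def[symmetric] key[symmetric] distrib_left[of "z ^ 6 * x\<^sup>2"]
    by (simp only: add_ac)
qed

section \<open>Coefficient inequalities from adding or deleting one part\<close>

text \<open>A nonempty partition arises by adding some part \<open>s\<close>, and every part is at
  least \<open>a\<close>. Partitions may be hit several times, hence only an inequality.\<close>

lemma gf_nth_le_sum_remove_part:
  assumes "m > 0" "a \<le> 2 * j + 1" "a \<le> 2 * k"
  shows "gf j k $ m \<le> (\<Sum>s=a..m. gf j k $ (m - s))"
proof -
  have "parts_from j k m \<subseteq> (\<Union>s\<in>{a..m}. add_mset s ` parts_from j k (m - s))"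
  proof
    fix M assume M: "M \<in> parts_from j k m"
    with assms(1) have "M \<noteq> {#}" by (auto simp: parts_from_def P_od_def)
    then obtain s N where "M = add_mset s N" by (metis multiset_cases)
    moreover from this have "N \<in> parts_from j k (m - s)" "s \<in> {a..m}"
      using parts_from_add_msetD[of s N j k m] M assms by (cases "odd s"; auto)+
    ultimately show "M \<in> (\<Union>s\<in>{a..m}. add_mset s ` parts_from j k (m - s))" by blast
  qed
  then have "card (parts_from j k m) \<le> card (\<Union>s\<in>{a..m}. add_mset s ` parts_from j k (m - s))"
    by (intro card_mono) (auto simp: finite_parts_from)
  also have "\<dots> \<le> (\<Sum>s=a..m. card (add_mset s ` parts_from j k (m - s)))"
    by (rule card_UN_le) simp
  also have "\<dots> = (\<Sum>s=a..m. card (parts_from j k (m - s)))"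
    by (simp add: card_image inj_on_def)
  finally show ?thesis by (simp add: gf_nth flip: of_nat_sum)
qed

lemma gf_nth_mono_even:
  assumes "even s" "2 * k \<le> s" "0 < s"
  shows "gf j k $ m \<le> gf j k $ (m + s)"
proof -
  have "add_mset s ` parts_from j k m \<subseteq> parts_from j k (m + s)"
    using assms by (auto simp: parts_from_def P_od_def)
  from card_mono[OF finite_parts_from this] show ?thesis
    by (simp add: gf_nth card_image inj_on_def)
qed

lemma gf_nth_pos:
  assumes "m = 0 \<or> odd m \<and> 2 * j + 1 \<le> m \<or> even m \<and> 2 * k \<le> m"
  shows "0 < gf j k $ m"
proof -
  have "(if m = 0 then {#} else {#m#}) \<in> parts_from j k m"
    using assms by (auto simp: parts_from_def P_od_def)
  then show ?thesis
    by (auto simp: gf_nth card_gt_0_iff finite_parts_from)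
qed

text \<open>
  The coefficients of
  \<open>L = (1 + q^3) (1 + 2q - 2q^2 + 2q^3 - 2q^7 + 2q^8) / (1 - q^4) + 2q^10 - 2q^11 - 2q^20\<close>
  and of \<open>C = L / (1 - q^6)\<close>.
\<close>

definition lcoef :: "nat \<Rightarrow> int" where
  "lcoef e = (if e < 21
     then [1, 2, -2, 3, 3, 0, 0, 1, 5, 0, 0, 1, 5, 0, -2, 3, 5, 0, -2, 3, 3] ! e
     else [5, 0, -2, 3] ! (e mod 4))"

fun ccoef :: "nat \<Rightarrow> int" where
  "ccoef e = lcoef e + (if e < 6 then 0 else ccoef (e - 6))"

declare ccoef.simps [simp del]

lemma ccoef_fps: "(1 - fps_X ^ 6) * Abs_fps ccoef = Abs_fps lcoef"
proof (rule fps_ext)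
  fix n
  show "((1 - fps_X ^ 6) * Abs_fps ccoef) $ n = Abs_fps lcoef $ n"
    using ccoef.simps[of n] by (simp add: left_diff_distrib fps_X_power_mult_nth)
qed

text \<open>Checks the table \<open>lcoef\<close> against the closed form of \<open>L\<close>, with
  the denominator cleared.\<close>

lemma lcoef_fps:
  "(1 - fps_X ^ 4) * Abs_fps lcoef
   = (1 + fps_X ^ 3) * (1 + 2 * fps_X - 2 * fps_X ^ 2 + 2 * fps_X ^ 3 - 2 * fps_X ^ 7 + 2 * fps_X ^ 8)
     + (1 - fps_X ^ 4) * (2 * fps_X ^ 10 - 2 * fps_X ^ 11 - 2 * fps_X ^ 20)"
  (is "?L = ?R")
proof (rule fps_ext)
  fix n
  define x :: "int fps" where "x = fps_X"
  have R: "?R = x ^ 0 + 2 * x ^ 1 - 2 * x ^ 2 + 3 * x ^ 3 + 2 * x ^ 4 - 2 * x ^ 5 + 2 * x ^ 6 - 2 * x ^ 7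
      + 2 * x ^ 8 - 2 * x ^ 14 + 2 * x ^ 15 - 2 * x ^ 20 + 2 * x ^ 24"
    unfolding x_def[symmetric] by algebra
  have L: "?L $ n = lcoef n - (if n < 4 then 0 else lcoef (n - 4))"
    by (simp add: left_diff_distrib fps_X_power_mult_nth)
  have Rn: "?R $ n = of_bool (n = 0) + 2 * of_bool (n = 1) - 2 * of_bool (n = 2) + 3 * of_bool (n = 3)
      + 2 * of_bool (n = 4) - 2 * of_bool (n = 5) + 2 * of_bool (n = 6) - 2 * of_bool (n = 7)
      + 2 * of_bool (n = 8) - 2 * of_bool (n = 14) + 2 * of_bool (n = 15) - 2 * of_bool (n = 20)
      + 2 * of_bool (n = 24)"
    unfolding R unfolding x_def numeral_fps_const fps_add_nth fps_sub_nth fps_mult_left_const_nth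
      fps_X_power_nth of_bool_def ..
  show "?L $ n = ?R $ n"
  \<comment> \<open>The right side has degree 24 and \<open>lcoef\<close> has period 4 from 21 on,
    so only finitely many coefficients need evaluation.\<close>
  proof (cases "n < 25")
    case True
    then have "n \<in> {0, 1, 2, 3, 4, 5, 6, 7, 8, 9, 10, 11, 12, 13, 14, 15, 16, 17, 18, 19, 20, 21, 22, 23, 24}"
      by (simp only: insert_iff empty_iff) presburger
    then show ?thesis
      unfolding L Rn insert_iff empty_iff
      by (elim disjE; hypsubst?; simp add: lcoef_def)
  next
    case False
    then obtain k where "n = k + 4" "k \<ge> 21"
      by (intro that[of "n - 4"]) auto
    then have "lcoef n = lcoef (n - 4)" by (simp add: lcoef_def)
    with False show ?thesis
      unfolding L Rn by simp
  qed
qed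

lemma ccoef_values:
  "ccoef 0 = 1" "ccoef 1 = 2" "ccoef 2 = -2" "ccoef 3 = 3" "ccoef 4 = 3" "ccoef 5 = 0" "ccoef 6 = 1"
  "ccoef 11 = 1" "ccoef 14 = 1" "ccoef 17 = 1"
  by (simp_all add: ccoef.simps lcoef_def)

lemma ccoef_ge_2:
  assumes "e \<ge> 7" "e \<noteq> 11" "e \<noteq> 14" "e \<noteq> 17"
  shows "ccoef e \<ge> 2"
  using assms
proof (induction e rule: less_induct)
  case (less e)
  show ?case
  proof (cases "e < 30")
    case True
    then have "e \<in> {7, 8, 9, 10, 11, 12, 13, 14, 15, 16, 17, 18, 19, 20, 21, 22, 23, 24, 25, 26, 27, 28, 29}"
      using less.prems by (simp only: insert_iff empty_iff) presburger
    then show ?thesis using less.prems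
      unfolding insert_iff empty_iff
      by (elim disjE; hypsubst?; simp add: ccoef.simps lcoef_def)
  next
    case False
    \<comment> \<open>Indices 6 apart pair the periodic values as 5 with -2 and 0 with 3. Hence the
      induction goes in steps of 12; from 30 on, \<open>e - 12\<close> lies beyond the exception
      17.\<close>
    have "lcoef e + lcoef (e - 6) \<ge> 0"
    proof -
      obtain k where k: "e = k + 6" "k \<ge> 24"
        using False by (intro that[of "e - 6"]) auto
      have "k mod 4 < 4" by simp
      then consider "k mod 4 = 0" | "k mod 4 = 1" | "k mod 4 = 2" | "k mod 4 = 3" by linarith
      then show ?thesis
        using k mod_add_left_eq[of k 4 6] by cases (simp_all add: lcoef_def)
    qed
    moreover from False have "\<not> e < 6" "\<not> e - 6 < 6" by auto
    then have "ccoef e = lcoef e + lcoef (e - 6) + ccoef (e - 12)"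
      using ccoef.simps[of e] ccoef.simps[of "e - 6"] by simp
    moreover have "ccoef (e - 12) \<ge> 2" using False less by simp
    ultimately show ?thesis by linarith
  qed
qed

section \<open>Bounds for the stair sums and the first difference of sigma\<close>

lemma stair_sum_nth_nonneg: "0 \<le> stair_sum k J $ n"
  by (simp add: stair_sum_def fps_sum_nth fps_X_power_mult_nth gf_nth_nonneg sum_nonneg)

lemma gf_le_stair_sum:
  assumes "J > 0"
  shows "gf k (Suc k) $ n \<le> stair_sum k J $ n"
proof -
  define t where "t i = (fps_X ^ (i\<^sup>2 + 4 * k * i) * gf (i + k) (Suc k)) $ n" for i
  have "t 0 \<le> (\<Sum>i<J. t i)"
    using assms by (intro member_le_sum) (auto simp: t_def fps_X_power_mult_nth gf_nth_nonneg)
  then show ?thesis by (simp add: t_def stair_sum_def fps_sum_nth)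
qed

lemma stair_sum_le_gf: "stair_sum k J $ n \<le> ((1 + fps_X ^ (4 * k + 1)) * gf k (Suc k)) $ n"
proof -
  have "0 \<le> (fps_X ^ (6 * k + 2) * stair_sum (Suc k) J) $ n"
    by (simp add: fps_X_power_mult_nth stair_sum_nth_nonneg del: power_Suc)
  moreover have "0 \<le> (fps_X ^ (J\<^sup>2 + 4 * k * J) * (1 + fps_X ^ (2 * J + 4 * k + 1)) * gf (J + k) (Suc k)) $ n"
    by (simp add: mult.assoc fps_X_power_mult_nth distrib_right gf_nth_nonneg del: power_Suc)
  ultimately show ?thesis
    unfolding stair_sum_step[of k J, symmetric] fps_add_nth by linarith
qed

lemma sigma_od_moex_diff:
  assumes "Suc n < J\<^sup>2"
  shows "int (sigma_od_moex (Suc n)) - int (sigma_od_moex n)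
    = (gf 1 2 * (1 + 2 * fps_X - 2 * fps_X ^ 2 + 2 * fps_X ^ 3 - 2 * fps_X ^ 7 + 2 * fps_X ^ 8)) $ Suc n
      + 2 * (fps_X ^ 10 * stair_sum 2 J) $ Suc n - 2 * (fps_X ^ 11 * stair_sum 2 J) $ Suc n"
proof -
  define x :: "int fps" where "x = fps_X"
  \<comment> \<open>The generating function of sigma after the steps \<open>k = 0\<close> and
    \<open>k = 1\<close>, without the remainders. These carry the factor \<open>w\<close>, so they
    do not affect coefficients below \<open>J\<^sup>2\<close>.\<close>
  define s where "s = (1 + 2 * x) * gf 0 1 - 2 * x ^ 2 * (1 + x ^ 5) * gf 1 2 + 2 * x ^ 10 * stair_sum 2 J"
  define a where "a = (1 + x ^ (2 * J + 1)) * gf J 1"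
  define b where "b = x ^ (4 * J) * (1 + x ^ (2 * J + 5)) * gf (J + 1) 2"
  define w where "w = x ^ J\<^sup>2"
  have st0: "stair_sum 0 J + x ^ 2 * stair_sum 1 J + w * a = (1 + x) * gf 0 1"
    using stair_sum_step[of 0 J] by (simp add: x_def a_def w_def power2_eq_square[of fps_X] mult.assoc)
  have arith: "Suc 1 = 2" "6 * 1 + 2 = (8 :: nat)" "2 * J + 4 * 1 + 1 = 2 * J + 5" "4 * 1 + 1 = (5 :: nat)"
    "4 * 1 * J = 4 * J"
    by simp_all
  have st1: "stair_sum 1 J + x ^ 8 * stair_sum 2 J + w * b = (1 + x ^ 5) * gf 1 2"
    using stair_sum_step[of 1 J] unfolding arith power_add[of _ "J\<^sup>2"]
    by (simp only: x_def b_def w_def mult.assoc)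
  have "2 * stair_sum 0 J - gf 0 1 = s + w * (2 * x ^ 2 * b - 2 * a)"
    using st0 st1 unfolding s_def by algebra
  then have sig: "int (sigma_od_moex m) = s $ m" if "m < J\<^sup>2" for m
    using sigma_od_moex_eq[OF that] that by (simp add: x_def w_def fps_X_power_mult_nth)
  have "gf 0 1 = (1 + x) * gf 1 1" "gf 1 1 = gf 1 2 + x ^ 2 * gf 1 1"
    using gf_odd_step[of 0 1] gf_even_step[of 1 1] by (simp_all add: x_def flip: numeral_2_eq_2)
  \<comment> \<open>The parts 1 and 2 contribute (1 + q) / (1 - q^2) = 1 / (1 - q), which
    differencing cancels.\<close>
  then have gf12: "gf 1 2 = (1 - x) * gf 0 1" by algebra
  have D: "(1 - x) * s = gf 1 2 * (1 + 2 * x - 2 * x ^ 2 + 2 * x ^ 3 - 2 * x ^ 7 + 2 * x ^ 8)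
      + 2 * (x ^ 10 * stair_sum 2 J) - 2 * (x ^ 11 * stair_sum 2 J)"
    unfolding s_def gf12 by algebra
  have "int (sigma_od_moex (Suc n)) - int (sigma_od_moex n) = ((1 - x) * s) $ Suc n"
    using sig[of n] sig[of "Suc n"] assms by (simp add: left_diff_distrib x_def)
  also have "\<dots> = (gf 1 2 * (1 + 2 * x - 2 * x ^ 2 + 2 * x ^ 3 - 2 * x ^ 7 + 2 * x ^ 8)) $ Suc n
      + 2 * (x ^ 10 * stair_sum 2 J) $ Suc n - 2 * (x ^ 11 * stair_sum 2 J) $ Suc n"
  proof -
    have "(2 * f) $ i = 2 * f $ i" for f :: "int fps" and i
      by (simp add: numeral_fps_const)
    then show ?thesis unfolding D fps_add_nth fps_sub_nth by presburger
  qed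
  finally show ?thesis unfolding x_def .
qed

text \<open>The right side is the lower bound for the first difference once \<open>U\<close> is
  replaced by its bounds. Both sides are compared after multiplying by (1 - q^4)(1 - q^6), which is
  then cancelled.\<close>

lemma ccoef_gf:
  "Abs_fps ccoef * gf 2 4
   = gf 1 2 * (1 + 2 * fps_X - 2 * fps_X ^ 2 + 2 * fps_X ^ 3 - 2 * fps_X ^ 7 + 2 * fps_X ^ 8)
     + (2 * fps_X ^ 10 - 2 * fps_X ^ 11 - 2 * fps_X ^ 20) * gf 2 3"
  (is "?L = ?R")
proof -
  define x :: "int fps" where "x = fps_X"
  have 1: "gf 1 2 = (1 + x ^ 3) * gf 2 2"
    using gf_odd_step[of 1 2] by (simp add: x_def numeral_2_eq_2 numeral_3_eq_3)
  have 2: "(1 - x ^ 4) * gf 2 2 = gf 2 3"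
    using gf_even_step[of 2 2] by (simp add: x_def left_diff_distrib diff_eq_eq)
  have 3: "(1 - x ^ 6) * gf 2 3 = gf 2 4"
    using gf_even_step[of 3 2] by (simp add: x_def left_diff_distrib diff_eq_eq)
  have L: "(1 - x ^ 4) * ((1 - x ^ 6) * ?L)
      = ((1 + x ^ 3) * (1 + 2 * x - 2 * x ^ 2 + 2 * x ^ 3 - 2 * x ^ 7 + 2 * x ^ 8)
          + (1 - x ^ 4) * (2 * x ^ 10 - 2 * x ^ 11 - 2 * x ^ 20)) * gf 2 4"
    using ccoef_fps lcoef_fps unfolding x_def[symmetric] by (metis mult.assoc)
  have R: "(1 - x ^ 4) * ((1 - x ^ 6) * ?R)
      = ((1 + x ^ 3) * (1 + 2 * x - 2 * x ^ 2 + 2 * x ^ 3 - 2 * x ^ 7 + 2 * x ^ 8)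
          + (1 - x ^ 4) * (2 * x ^ 10 - 2 * x ^ 11 - 2 * x ^ 20)) * gf 2 4"
    using 1 2 3 unfolding x_def[symmetric] by algebra
  have "(1 - x ^ k) \<noteq> 0" if "k > 0" for k
  proof
    assume "1 - x ^ k = 0"
    then have "(1 - x ^ k) $ 0 = 0" by simp
    with that show False by (simp add: x_def)
  qed
  with L R show ?thesis by (metis mult_left_cancel zero_less_numeral)
qed

lemma ccoef_gf_nth_pos:
  assumes "m \<ge> 5"
  shows "0 < (Abs_fps ccoef * gf 2 4) $ m"
proof -
  \<comment> \<open>The explicit 0 beyond \<open>m\<close> is needed: truncated subtraction would
    give the constant coefficient 1 there.\<close>
  define u where "u e = (if e \<le> m then gf 2 4 $ (m - e) else 0)" for e
  have u_nonneg: "0 \<le> u e" for e by (simp add: u_def gf_nth_nonneg)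
  have u_mono: "u (e + s) \<le> u e" if "even s" "8 \<le> s" for e s
    using gf_nth_mono_even[of s 4 2 "m - (e + s)"] that by (auto simp: u_def gf_nth_nonneg)
  \<comment> \<open>Large enough for the exceptional indices 11, 14 and 17 to lie in the range for
    every \<open>m\<close>.\<close>
  define K where "K = m + 20"
  have "(Abs_fps ccoef * gf 2 4) $ m = (\<Sum>e=0..m. ccoef e * u e)"
    by (simp add: fps_mult_nth u_def)
  also have "\<dots> = (\<Sum>e=0..K. ccoef e * u e)"
    by (rule sum.mono_neutral_left) (auto simp: K_def u_def)
  also have "\<dots> = (\<Sum>e=0..<7. ccoef e * u e) + (\<Sum>e=7..K. ccoef e * u e)"
  proof -
    have "{0..K} = {0..<7} \<union> {7..K}" by (auto simp: K_def)
    then show ?thesis by (metis (no_types, lifting) finite_atLeastAtMost finite_atLeastLessThan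
      ivl_disj_int_two(7) sum.union_disjoint)
  qed
  also have "(\<Sum>e=0..<7. ccoef e * u e) = u 0 + 2 * u 1 - 2 * u 2 + 3 * u 3 + 3 * u 4 + u 6"
    using ccoef_values by (simp add: eval_nat_numeral)
  finally have eq: "(Abs_fps ccoef * gf 2 4) $ m
      = u 0 + 2 * u 1 - 2 * u 2 + 3 * u 3 + 3 * u 4 + u 6 + (\<Sum>e=7..K. ccoef e * u e)" .
  have "(\<Sum>e=7..K. 2 * u e - (if e = 11 then u e else 0) - (if e = 14 then u e else 0)
      - (if e = 17 then u e else 0)) \<le> (\<Sum>e=7..K. ccoef e * u e)"
  proof (rule sum_mono)
    fix e assume "e \<in> {7..K}"
    then show "2 * u e - (if e = 11 then u e else 0) - (if e = 14 then u e else 0)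
      - (if e = 17 then u e else 0) \<le> ccoef e * u e"
      using ccoef_values mult_right_mono[OF ccoef_ge_2[of e] u_nonneg[of e]] by auto
  qed
  then have "2 * (\<Sum>e=7..K. u e) - u 11 - u 14 - u 17 \<le> (\<Sum>e=7..K. ccoef e * u e)"
    by (simp add: sum_subtractf sum_distrib_left sum.delta K_def)
  \<comment> \<open>All parts counted by \<open>gf 2 4\<close> are at least 5, so deleting a part
    \<open>s\<close> leads from index 2 to index \<open>s + 2\<close>, at least 7.\<close>
  moreover have "u 2 \<le> (\<Sum>e=7..K. u e)"
  proof -
    have "u 2 \<le> (\<Sum>s=5..m-2. gf 2 4 $ (m - 2 - s))"
      using gf_nth_le_sum_remove_part[of "m - 2" 5 2 4] assms by (simp add: u_def)
    also have "\<dots> = (\<Sum>e=5+2..m-2+2. u e)"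
      unfolding sum.shift_bounds_cl_nat_ivl by (intro sum.cong) (auto simp: u_def)
    also have "\<dots> \<le> (\<Sum>e=7..K. u e)"
      by (rule sum_mono2) (use assms in \<open>auto simp: K_def u_nonneg\<close>)
    finally show ?thesis .
  qed
  \<comment> \<open>The coefficients of \<open>C\<close> at 11, 14 and 17 are one too small; the surplus at 3, 4 and 1 makes up for it.\<close>
  moreover have "u 11 \<le> u 3" "u 14 \<le> u 4" "u 17 \<le> u 1"
    using u_mono[of 8 3] u_mono[of 10 4] u_mono[of 16 1] by simp_all
  \<comment> \<open>Strictness: the single part \<open>m\<close> counts in \<open>u 0\<close> unless
    \<open>m = 6\<close>, which is an even part below 8; then the empty partition counts in
    \<open>u 6\<close>.\<close>
  moreover have "0 < u 0 + u 6"
  proof (cases "m = 6")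
    case True
    then have "0 < u 6" using gf_nth_pos[of 0 2 4] by (simp add: u_def)
    then show ?thesis using u_nonneg[of 0] by simp
  next
    case False
    with assms have "even m \<longrightarrow> 8 \<le> m" by presburger
    then have "0 < gf 2 4 $ m" using assms by (intro gf_nth_pos) auto
    then show ?thesis using u_nonneg[of 6] by (simp add: u_def)
  qed
  ultimately show ?thesis
    using eq u_nonneg[of 1] u_nonneg[of 3] u_nonneg[of 4] by linarith
qed

theorem theorem1p6:
  fixes n :: nat
  assumes "n \<ge> 4"
  shows "sigma_od_moex (n + 1) > sigma_od_moex n"
proof -
  define J where "J = n + 2"
  have J: "Suc n < J\<^sup>2" "J > 0" by (simp_all add: J_def power2_eq_square)
  let ?m = "Suc n"
  \<comment> \<open>\<open>U\<close> enters with factor 2q^10 - 2q^11, so it is bounded above in the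
    negative term and below in the positive one.\<close>
  have up: "(fps_X ^ 11 * stair_sum 2 J) $ ?m \<le> (fps_X ^ 11 * ((1 + fps_X ^ 9) * gf 2 3)) $ ?m"
    using stair_sum_le_gf[of 2 J] by (simp add: fps_X_power_mult_nth)
  have lo: "(fps_X ^ 10 * gf 2 3) $ ?m \<le> (fps_X ^ 10 * stair_sum 2 J) $ ?m"
    using gf_le_stair_sum[of J 2] J by (simp add: fps_X_power_mult_nth)
  have "(2 * fps_X ^ 10 - 2 * fps_X ^ 11 - 2 * fps_X ^ 20) * gf 2 3
      = 2 * (fps_X ^ 10 * gf 2 3) - 2 * (fps_X ^ 11 * ((1 + fps_X ^ 9) * gf 2 3))"
    by algebra
  then have "((2 * fps_X ^ 10 - 2 * fps_X ^ 11 - 2 * fps_X ^ 20) * gf 2 3) $ ?m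
      = 2 * (fps_X ^ 10 * gf 2 3) $ ?m - 2 * (fps_X ^ 11 * ((1 + fps_X ^ 9) * gf 2 3)) $ ?m"
    by (simp only: numeral_fps_const fps_sub_nth fps_mult_left_const_nth)
  moreover have "0 < (Abs_fps ccoef * gf 2 4) $ ?m"
    using assms by (intro ccoef_gf_nth_pos) simp
  ultimately have "int (sigma_od_moex (Suc n)) - int (sigma_od_moex n) > 0"
    using up lo unfolding sigma_od_moex_diff[OF J(1)] ccoef_gf fps_add_nth by linarith
  then show ?thesis by simp
qed

end
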